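(* Let $Q=(q_{ij})$ be a real symmetric $n\times n$ matrix with zero diagonal, $c\in\mathbb{R}^n$, $R_i=\{j:q_{ij}\neq0\}$, and let $\gamma_{ij}>0$ and $\delta_{ij}>0$ for $j\in R_i$, $i=1,\dots,n$. Consider the MILP GW($*,\gamma,\delta$) in variables $x_i$ and $y_{ij}$ ($j\in R_i$): maximize $\sum_{i=1}^n\sum_{j\in R_i}q_{ij}y_{ij}+\sum_{i=1}^n c_ix_i$ subject to $x_i+x_j-y_{ij}\le 1$ for all $j\in R_i$, $i=1,\dots,n$; $\sum_{j\in R_i}\gamma_{ij}y_{ij}\le\left(\sum_{j\in R_i}\gamma_{ij}\right)x_i$ for $i=1,\dots,n$; $\sum_{j\in R_i}\delta_{ij}y_{ji}\le\left(\sum_{j\in R_i}\delta_{ij}\right)x_i$ for $i=1,\dots,n$; $x_i\in\{0,1\}$ for all $i$; $0\le y_{ij}\le 1$ for all $j\in R_i$, $i=1,\dots,n$. Then GW($*,\gamma,\delta$) is a valid formulation of QUBO.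
   Context: QUBO is the problem: maximize $\sum_{i=1}^n\sum_{j\in R_i}q_{ij}x_ix_j+\sum_{i=1}^n c_ix_i$ over $x\in\{0,1\}^n$. An MILP in variables $(x,y)$ with objective $\sum_i\sum_{j\in R_i}q_{ij}y_{ij}+\sum_i c_ix_i$ is a valid formulation of QUBO if its optimal objective value equals the optimal value of QUBO and the $x$-part of every optimal solution of the MILP is an optimal solution of QUBO. *)

theory Defs
  imports "HOL-Analysis.Analysis"
begin

definition R :: "real^'n^'n \<Rightarrow> 'n \<Rightarrow> 'n set" where
  "R Q i = {j. Q $ i $ j \<noteq> 0}"

(* v is the (attained) optimal value of "maximize f over S" *)
definition has_optimal_value :: "'a set \<Rightarrow> ('a \<Rightarrow> real) \<Rightarrow> real \<Rightarrow> bool" where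
  "has_optimal_value S f v \<longleftrightarrow> (\<exists>s. is_arg_max f (\<lambda>t. t \<in> S) s \<and> f s = v)"

definition binary_vectors :: "(real^'n) set" where
  "binary_vectors = {x. \<forall>i. x $ i \<in> {0, 1}}"

definition qubo_objective :: "real^'n^'n \<Rightarrow> real^'n \<Rightarrow> real^'n \<Rightarrow> real" where
  "qubo_objective Q c x =
     (\<Sum>i\<in>UNIV. \<Sum>j\<in>R Q i. Q $ i $ j * x $ i * x $ j) + (\<Sum>i\<in>UNIV. c $ i * x $ i)"

definition milp_objective ::
  "real^'n^'n \<Rightarrow> real^'n \<Rightarrow> (real^'n) \<times> ('n \<times> 'n \<Rightarrow> real) \<Rightarrow> real" where
  "milp_objective Q c = (\<lambda>(x, y).
     (\<Sum>i\<in>UNIV. \<Sum>j\<in>R Q i. Q $ i $ j * y (i, j)) + (\<Sum>i\<in>UNIV. c $ i * x $ i))"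

(* An MILP with this objective is given by its set F of feasible points (x, y). *)
definition valid_qubo_formulation ::
  "real^'n^'n \<Rightarrow> real^'n \<Rightarrow> ((real^'n) \<times> ('n \<times> 'n \<Rightarrow> real)) set \<Rightarrow> bool" where
  "valid_qubo_formulation Q c F \<longleftrightarrow>
     (\<exists>v. has_optimal_value F (milp_objective Q c) v \<and>
          has_optimal_value binary_vectors (qubo_objective Q c) v) \<and>
     (\<forall>x y. is_arg_max (milp_objective Q c) (\<lambda>z. z \<in> F) (x, y) \<longrightarrow>
            is_arg_max (qubo_objective Q c) (\<lambda>x. x \<in> binary_vectors) x)"

(* The variables y (i, j) exist only for j \<in> R Q i; the extensional function space in the
   last conjunct expresses this together with the bounds 0 \<le> y (i, j) \<le> 1. *)
definition GW_feasible ::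
  "real^'n^'n \<Rightarrow> ('n \<Rightarrow> 'n \<Rightarrow> real) \<Rightarrow> ('n \<Rightarrow> 'n \<Rightarrow> real)
     \<Rightarrow> ((real^'n) \<times> ('n \<times> 'n \<Rightarrow> real)) set" where
  "GW_feasible Q \<gamma> \<delta> = {(x, y).
     (\<forall>i. \<forall>j\<in>R Q i. x $ i + x $ j - y (i, j) \<le> 1) \<and>
     (\<forall>i. (\<Sum>j\<in>R Q i. \<gamma> i j * y (i, j)) \<le> (\<Sum>j\<in>R Q i. \<gamma> i j) * x $ i) \<and>
     (\<forall>i. (\<Sum>j\<in>R Q i. \<delta> i j * y (j, i)) \<le> (\<Sum>j\<in>R Q i. \<delta> i j) * x $ i) \<and>
     (\<forall>i. x $ i \<in> {0, 1}) \<and>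
     y \<in> (SIGMA i:UNIV. R Q i) \<rightarrow>\<^sub>E {0..1}}"

end

(* On binary x the constraints force y (i, j) = x i * x j.  If x i = 0, the aggregated
   constraints for i bound a positively weighted sum of nonnegative terms by 0, which kills
   y (i, j) and y (j, i) for all j in R Q i; symmetry of Q then also kills y (i, j) when
   x j = 0.  So the MILP is QUBO with the feasible region relabelled by a bijection. *)
theory Submission
  imports Defs
begin

text \<open>Off the index set \<open>restrict\<close> returns \<open>undefined\<close>, the value
  that the extensional function space in \<open>GW_feasible\<close> prescribes. So equality of
  points can hold literally, not just on the index set.\<close>

definition product_point :: "real^'n^'n \<Rightarrow> real^'n \<Rightarrow> (real^'n) \<times> ('n \<times> 'n \<Rightarrow> real)" where
  "product_point Q x = (x, restrict (\<lambda>(i, j). x $ i * x $ j) (SIGMA i:UNIV. R Q i))"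

lemma milp_objective_product_point:
  "milp_objective Q c (product_point Q x) = qubo_objective Q c x"
  by (simp add: milp_objective_def product_point_def qubo_objective_def mult.assoc)

text \<open>Ensures that \<open>y (j, i)\<close> in the \<delta>-constraint for i is a genuine
  variable, not a default value, whenever \<open>j \<in> R Q i\<close>.\<close>

lemma R_sym:
  assumes "transpose Q = Q"
  shows "j \<in> R Q i \<longleftrightarrow> i \<in> R Q j"
proof -
  have "Q $ i $ j = Q $ j $ i"
    using arg_cong[OF assms, of "\<lambda>A. A $ i $ j"] by (simp add: transpose_def)
  then show ?thesis by (simp add: R_def)
qed

text \<open>Nonnegative terms with sum at most 0 all vanish, and a positive weight can be
  cancelled.\<close>

lemma weighted_sum_nonpos_imp_zero:
  fixes w y :: "'a \<Rightarrow> real"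
  assumes "finite A" "\<And>j. j \<in> A \<Longrightarrow> w j > 0" "\<And>j. j \<in> A \<Longrightarrow> y j \<ge> 0"
    and "(\<Sum>j\<in>A. w j * y j) \<le> 0" "j \<in> A"
  shows "y j = 0"
proof -
  have nonneg: "\<And>j. j \<in> A \<Longrightarrow> 0 \<le> w j * y j"
    using assms(2,3) by (simp add: less_imp_le)
  then have "(\<Sum>j\<in>A. w j * y j) = 0"
    using assms(4) by (meson antisym sum_nonneg)
  then have "w j * y j = 0"
    using assms(1,5) nonneg by (simp add: sum_nonneg_eq_0_iff)
  then show ?thesis using assms(2)[OF assms(5)] by simp
qed

text \<open>The aggregated constraints hold term by term: on binary points a product is at most
  either factor, and nonnegative weights preserve this.\<close>

lemma product_point_feasible:
  assumes sym: "transpose Q = Q"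
    and \<gamma>: "\<And>i j. j \<in> R Q i \<Longrightarrow> \<gamma> i j \<ge> 0"
    and \<delta>: "\<And>i j. j \<in> R Q i \<Longrightarrow> \<delta> i j \<ge> 0"
    and x: "x \<in> binary_vectors"
  shows "product_point Q x \<in> GW_feasible Q \<gamma> \<delta>"
proof -
  have bin: "x $ i = 0 \<or> x $ i = 1" for i
    using x by (auto simp: binary_vectors_def)
  have prod: "x $ i * x $ j \<in> {0..1}" for i j
    using bin[of i] bin[of j] by auto
  \<comment> \<open>Both orders of the factors occur: i is the first index in the
    \<gamma>-constraint and the second in the \<delta>-constraint.\<close>
  have bound: "w * (x $ i * x $ j) \<le> w * x $ i" "w * (x $ j * x $ i) \<le> w * x $ i"
    if "w \<ge> 0" for w i j
    using bin[of i] bin[of j] that by auto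
  have row: "(\<Sum>j\<in>R Q i. \<gamma> i j * (x $ i * x $ j)) \<le> (\<Sum>j\<in>R Q i. \<gamma> i j) * x $ i" for i
    unfolding sum_distrib_right by (intro sum_mono bound \<gamma>)
  have col: "(\<Sum>j\<in>R Q i. \<delta> i j * (x $ j * x $ i)) \<le> (\<Sum>j\<in>R Q i. \<delta> i j) * x $ i" for i
    unfolding sum_distrib_right by (intro sum_mono bound \<delta>)
  have cover: "x $ i + x $ j - x $ i * x $ j \<le> 1" for i j
    using bin[of i] bin[of j] by auto
  define y where "y = restrict (\<lambda>(i, j). x $ i * x $ j) (SIGMA i:UNIV. R Q i)"
  have y: "y (i, j) = x $ i * x $ j" if "j \<in> R Q i" for i j
    using that by (simp add: y_def)
  have y': "y (j, i) = x $ j * x $ i" if "j \<in> R Q i" for i j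
    using that y R_sym[OF sym] by blast
  have PiE: "y \<in> (SIGMA i:UNIV. R Q i) \<rightarrow>\<^sub>E {0..1}"
  proof (rule PiE_I)
    fix p
    assume "p \<in> (SIGMA i:UNIV. R Q i)"
    then obtain i j where "p = (i, j)" "j \<in> R Q i" by blast
    then show "y p \<in> {0..1}" using y prod by simp
  qed (simp only: y_def restrict_apply if_False)
  have row': "(\<Sum>j\<in>R Q i. \<gamma> i j * y (i, j)) \<le> (\<Sum>j\<in>R Q i. \<gamma> i j) * x $ i" for i
    using row[of i] by (simp only: y cong: sum.cong)
  have col': "(\<Sum>j\<in>R Q i. \<delta> i j * y (j, i)) \<le> (\<Sum>j\<in>R Q i. \<delta> i j) * x $ i" for i
    using col[of i] by (simp only: y' cong: sum.cong)
  have cover': "x $ i + x $ j - y (i, j) \<le> 1" if "j \<in> R Q i" for i j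
    using cover[of i j] by (simp only: y[OF that])
  have "x $ i \<in> {0, 1}" for i
    using bin by blast
  then have "(x, y) \<in> GW_feasible Q \<gamma> \<delta>"
    unfolding GW_feasible_def mem_Collect_eq prod.case
    by (intro conjI allI ballI row' col' cover' PiE)
  then show ?thesis
    unfolding product_point_def y_def .
qed

lemma feasible_imp_product_point:
  assumes sym: "transpose Q = Q"
    and \<gamma>: "\<And>i j. j \<in> R Q i \<Longrightarrow> \<gamma> i j > 0"
    and \<delta>: "\<And>i j. j \<in> R Q i \<Longrightarrow> \<delta> i j > 0"
    and feas: "(x, y) \<in> GW_feasible Q \<gamma> \<delta>"
  shows "x \<in> binary_vectors" and "(x, y) = product_point Q x"
proof -
  have cover: "\<And>i j. j \<in> R Q i \<Longrightarrow> x $ i + x $ j - y (i, j) \<le> 1"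
    and row: "\<And>i. (\<Sum>j\<in>R Q i. \<gamma> i j * y (i, j)) \<le> (\<Sum>j\<in>R Q i. \<gamma> i j) * x $ i"
    and col: "\<And>i. (\<Sum>j\<in>R Q i. \<delta> i j * y (j, i)) \<le> (\<Sum>j\<in>R Q i. \<delta> i j) * x $ i"
    and bin: "\<And>i. x $ i \<in> {0, 1}"
    and y: "y \<in> (SIGMA i:UNIV. R Q i) \<rightarrow>\<^sub>E {0..1}"
    using feas by (auto simp: GW_feasible_def)
  show "x \<in> binary_vectors"
    using bin by (simp add: binary_vectors_def)
  have y01: "y (i, j) \<in> {0..1}" if "j \<in> R Q i" for i j
    using PiE_mem[OF y, of "(i, j)"] that by simp
  have row0: "y (i, j) = 0" if "j \<in> R Q i" "x $ i = 0" for i j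
    by (rule weighted_sum_nonpos_imp_zero[where A = "R Q i" and w = "\<gamma> i" and y = "\<lambda>j. y (i, j)"])
       (use that \<gamma> y01 row[of i] in auto)
  have col0: "y (j, i) = 0" if "j \<in> R Q i" "x $ i = 0" for i j
    by (rule weighted_sum_nonpos_imp_zero[where A = "R Q i" and w = "\<delta> i" and y = "\<lambda>j. y (j, i)"])
       (use that \<delta> y01 R_sym[OF sym] col[of i] in auto)
  have prod: "y (i, j) = x $ i * x $ j" if j: "j \<in> R Q i" for i j
  proof -
    consider "x $ i = 0" | "x $ j = 0" | "x $ i = 1" "x $ j = 1"
      using bin by blast
    then show ?thesis
    proof cases
      case 1
      then show ?thesis using row0 j by simp
    next
      case 2
      \<comment> \<open>\<open>col0\<close> is used with i and j exchanged, so it asks for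
        \<open>i \<in> R Q j\<close>.\<close>
      then show ?thesis using col0 j R_sym[OF sym] by simp
    next
      case 3
      \<comment> \<open>The constraint reads 1 + 1 - y \<le> 1, so y \<ge> 1, and the upper bound
        gives equality.\<close>
      then show ?thesis using cover[OF j] y01[OF j] by simp
    qed
  qed
  have "y = restrict (\<lambda>(i, j). x $ i * x $ j) (SIGMA i:UNIV. R Q i)"
  \<comment> \<open>Both functions are \<open>undefined\<close> off the index set, so agreement on
    it suffices.\<close>
  proof (rule extensionalityI)
    show "y \<in> extensional (SIGMA i:UNIV. R Q i)"
      using y by (simp add: PiE_def)
    fix p
    assume "p \<in> (SIGMA i:UNIV. R Q i)"
    then obtain i j where "p = (i, j)" "j \<in> R Q i" by blast
    then show "y p = restrict (\<lambda>(i, j). x $ i * x $ j) (SIGMA i:UNIV. R Q i) p"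
      by (simp add: prod)
  qed (rule restrict_extensional)
  then show "(x, y) = product_point Q x"
    by (simp add: product_point_def)
qed

text \<open>The weights disappear on the right: every positive choice of \<gamma> and \<delta> cuts
  out the same set, and maximizing over it becomes maximizing over binary vectors.\<close>

lemma GW_feasible_eq:
  assumes "transpose Q = Q"
    and "\<And>i j. j \<in> R Q i \<Longrightarrow> \<gamma> i j > 0"
    and "\<And>i j. j \<in> R Q i \<Longrightarrow> \<delta> i j > 0"
  shows "GW_feasible Q \<gamma> \<delta> = product_point Q ` binary_vectors"
proof
  show "GW_feasible Q \<gamma> \<delta> \<subseteq> product_point Q ` binary_vectors"
    using feasible_imp_product_point[OF assms] by fast
  show "product_point Q ` binary_vectors \<subseteq> GW_feasible Q \<gamma> \<delta>"
    by (intro image_subsetI product_point_feasible) (use assms in \<open>simp_all add: less_imp_le\<close>)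
qed

lemma finite_binary_vectors: "finite (binary_vectors :: (real^'n) set)"
proof -
  have "(binary_vectors :: (real^'n) set) \<subseteq> vec_lambda ` (UNIV \<rightarrow>\<^sub>E {0, 1})"
  proof
    fix x :: "real^'n"
    assume "x \<in> binary_vectors"
    then have "vec_nth x \<in> UNIV \<rightarrow>\<^sub>E {0, 1}"
      by (auto simp: binary_vectors_def)
    then show "x \<in> vec_lambda ` (UNIV \<rightarrow>\<^sub>E {0, 1})"
      by (metis image_eqI vec_nth_inverse)
  qed
  then show ?thesis
    by (rule finite_subset) (simp add: finite_PiE)
qed

text \<open>Supplies the attained maximum that \<open>has_optimal_value\<close> demands:
  \<open>Max\<close> of a finite nonempty image is one of its values.\<close>

lemma ex_is_arg_max_finite:
  fixes f :: "'a \<Rightarrow> 'b::linorder"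
  assumes "finite S" "S \<noteq> {}"
  shows "\<exists>s. is_arg_max f (\<lambda>t. t \<in> S) s"
proof -
  have "Max (f ` S) \<in> f ` S"
    using assms by (intro Max_in) simp_all
  then obtain s where "s \<in> S" "Max (f ` S) = f s" by blast
  moreover have "f t \<le> Max (f ` S)" if "t \<in> S" for t
    using assms(1) that by simp
  ultimately have "is_arg_max f (\<lambda>t. t \<in> S) s"
    by (simp add: is_arg_max_linorder)
  then show ?thesis ..
qed

text \<open>Values of f on the image are exactly the values of f after g on S; all preimages of z
  share the value f z.\<close>

lemma is_arg_max_image:
  fixes f :: "'b \<Rightarrow> 'c::linorder"
  shows "is_arg_max f (\<lambda>z. z \<in> g ` S) z \<longleftrightarrow>
    (\<exists>x. z = g x \<and> is_arg_max (\<lambda>x. f (g x)) (\<lambda>x. x \<in> S) x)"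
  by (auto simp: is_arg_max_linorder)

theorem theorem10:
  fixes Q :: "real^'n^'n" and c :: "real^'n"
    and \<gamma> \<delta> :: "'n \<Rightarrow> 'n \<Rightarrow> real"
  assumes "transpose Q = Q"
    and "\<And>i. Q $ i $ i = 0"
    and "\<And>i j. j \<in> R Q i \<Longrightarrow> \<gamma> i j > 0"
    and "\<And>i j. j \<in> R Q i \<Longrightarrow> \<delta> i j > 0"
  shows "valid_qubo_formulation Q c (GW_feasible Q \<gamma> \<delta>)"
proof -
  have feas: "GW_feasible Q \<gamma> \<delta> = product_point Q ` binary_vectors"
    using assms(1,3,4) by (rule GW_feasible_eq)
  \<comment> \<open>Stated between functions so that it rewrites the objective inside
    \<open>is_arg_max\<close>.\<close>
  have "(\<lambda>x. milp_objective Q c (product_point Q x)) = qubo_objective Q c"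
    by (simp add: milp_objective_product_point)
  then have arg_max: "is_arg_max (milp_objective Q c) (\<lambda>z. z \<in> GW_feasible Q \<gamma> \<delta>) z \<longleftrightarrow>
      (\<exists>x. z = product_point Q x \<and> is_arg_max (qubo_objective Q c) (\<lambda>x. x \<in> binary_vectors) x)" for z
    unfolding feas is_arg_max_image by simp
  have "0 \<in> (binary_vectors :: (real^'n) set)"
    by (simp add: binary_vectors_def)
  then obtain x where x: "is_arg_max (qubo_objective Q c) (\<lambda>x. x \<in> binary_vectors) x"
    using ex_is_arg_max_finite[OF finite_binary_vectors] by blast
  \<comment> \<open>One QUBO maximizer x yields maximizers of both problems with the same value, the
    common v.\<close>
  then have "is_arg_max (milp_objective Q c) (\<lambda>z. z \<in> GW_feasible Q \<gamma> \<delta>) (product_point Q x)"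
    using arg_max by blast
  then have opt: "has_optimal_value (GW_feasible Q \<gamma> \<delta>) (milp_objective Q c) (qubo_objective Q c x)"
    unfolding has_optimal_value_def using milp_objective_product_point by blast
  have "is_arg_max (qubo_objective Q c) (\<lambda>x. x \<in> binary_vectors) u"
    if "is_arg_max (milp_objective Q c) (\<lambda>z. z \<in> GW_feasible Q \<gamma> \<delta>) (u, y)" for u y
    \<comment> \<open>An optimal (u, y) is \<open>product_point Q x\<close> for some QUBO maximizer
      x; comparing first components gives u = x.\<close>
    using that by (auto simp: arg_max product_point_def)
  moreover have "has_optimal_value binary_vectors (qubo_objective Q c) (qubo_objective Q c x)"
    using x has_optimal_value_def by blast
  ultimately show ?thesis
    unfolding valid_qubo_formulation_def using opt by blast
qed

end
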